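(* Let $\Sigma$ be a finite non-empty alphabet. The map $\iota:\Sigma^*\to\widetilde{\Sigma}^*$, $\iota(w)=[(w)_\varepsilon]$, sending a finite word $w$ to the equivalence class of the constant net equal to $w$, is an injective monoid homomorphism.
   Context: $\Sigma^*$ is the free monoid of finite words over $\Sigma$ under concatenation, $\lambda$ is the empty word, $|w|$ is the length of $w$. For $u\neq v$ in $\Sigma^*$, $\operatorname{lcp}(u,v)$ and $\operatorname{lcs}(u,v)$ are the lengths of the longest common prefix and of the longest common suffix of $u,v$; by convention $\operatorname{lcp}(u,u)=\operatorname{lcs}(u,u)=+\infty$. A net of words is a family $(w_\varepsilon)_{\varepsilon\in(0,1]}$ of words in $\Sigma^*$. It is moderate if there exist $N\in\mathbb{N}$, $C>0$, $\varepsilon_0>0$ with $|w_\varepsilon|\le C\varepsilon^{-N}$ for all $\varepsilon<\varepsilon_0$. $\mathcal{E}_M(\Sigma^* )$ is the set of moderate nets. Two moderate nets are equivalent, $(u_\varepsilon)\sim(v_\varepsilon)$, if for every $m\in\mathbb{N}$ there exists $\varepsilon_0>0$ such that $\min\{\operatorname{lcp}(u_\varepsilon,v_\varepsilon),\operatorname{lcs}(u_\varepsilon,v_\varepsilon)\}\ge m\log_2(1/\varepsilon)$ for all $\varepsilon<\varepsilon_0$; this is an equivalence relation. $\widetilde{\Sigma}^*:=\mathcal{E}_M(\Sigma^* )/\sim$ is a monoid under the well-defined product $[(u_\varepsilon)]\cdot[(v_\varepsilon)]:=[(u_\varepsilon v_\varepsilon)]$, with identity $\mathbf{1}=[(\lambda)_\varepsilon]$.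 *)

theory Defs
  imports Complex_Main "HOL-Library.Sublist" "HOL-Library.Extended_Real" "HOL-Algebra.Group"
begin

text \<open>
  An alphabet is a set \<open>\<Sigma>\<close>, and the words over it are the elements of \<^term>\<open>lists \<Sigma>\<close>.
\<close>

definition word_monoid :: "'a set \<Rightarrow> 'a list monoid" where
  "word_monoid \<Sigma> = \<lparr>carrier = lists \<Sigma>, mult = (@), one = []\<rparr>"

definition longest_common_suffix :: "'a list \<Rightarrow> 'a list \<Rightarrow> 'a list" where
  "longest_common_suffix u v = (ARG_MAX length s. suffix s u \<and> suffix s v)"

definition lcp :: "'a list \<Rightarrow> 'a list \<Rightarrow> ereal" where
  "lcp u v = (if u = v then \<infinity> else ereal (real (length (longest_common_prefix u v))))"

definition lcs :: "'a list \<Rightarrow> 'a list \<Rightarrow> ereal" where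
  "lcs u v = (if u = v then \<infinity> else ereal (real (length (longest_common_suffix u v))))"

text \<open>
  Families indexed by \<open>(0, 1]\<close> are extensional functions on \<^term>\<open>{0<..1::real}\<close>, so that two nets
  are equal as soon as they agree on \<open>(0, 1]\<close>.
\<close>

definition nets :: "'a set \<Rightarrow> (real \<Rightarrow> 'a list) set" where
  "nets \<Sigma> = {0<..1} \<rightarrow>\<^sub>E lists \<Sigma>"

definition moderate :: "(real \<Rightarrow> 'a list) \<Rightarrow> bool" where
  "moderate w \<longleftrightarrow> (\<exists>N::nat. \<exists>C>0. \<exists>\<epsilon>0>0. \<forall>\<epsilon>\<in>{0<..1}. \<epsilon> < \<epsilon>0 \<longrightarrow>
     real (length (w \<epsilon>)) \<le> C * \<epsilon> powi (- int N))"

definition moderate_nets :: "'a set \<Rightarrow> (real \<Rightarrow> 'a list) set" where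
  "moderate_nets \<Sigma> = {w \<in> nets \<Sigma>. moderate w}"

definition net_equiv :: "'a set \<Rightarrow> ((real \<Rightarrow> 'a list) \<times> (real \<Rightarrow> 'a list)) set" where
  "net_equiv \<Sigma> = {(u, v). u \<in> moderate_nets \<Sigma> \<and> v \<in> moderate_nets \<Sigma> \<and>
     (\<forall>m::nat. \<exists>\<epsilon>0>0. \<forall>\<epsilon>\<in>{0<..1}. \<epsilon> < \<epsilon>0 \<longrightarrow>
        min (lcp (u \<epsilon>) (v \<epsilon>)) (lcs (u \<epsilon>) (v \<epsilon>)) \<ge> ereal (real m * log 2 (1 / \<epsilon>)))}"

definition net_class :: "'a set \<Rightarrow> (real \<Rightarrow> 'a list) \<Rightarrow> (real \<Rightarrow> 'a list) set" where
  "net_class \<Sigma> u = net_equiv \<Sigma> `` {u}"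

definition const_net :: "'a list \<Rightarrow> real \<Rightarrow> 'a list" where
  "const_net w = (\<lambda>\<epsilon>\<in>{0<..1}. w)"

definition net_append :: "(real \<Rightarrow> 'a list) \<Rightarrow> (real \<Rightarrow> 'a list) \<Rightarrow> real \<Rightarrow> 'a list" where
  "net_append u v = (\<lambda>\<epsilon>\<in>{0<..1}. u \<epsilon> @ v \<epsilon>)"

text \<open>
  All members of the union defining the product of two classes coincide, so that it is the class of
  \<^term>\<open>net_append u v\<close> for any choice of representatives: see \<open>mult_net_class\<close> below.
\<close>

definition gen_word_monoid :: "'a set \<Rightarrow> (real \<Rightarrow> 'a list) set monoid" where
  "gen_word_monoid \<Sigma> =
     \<lparr>carrier = moderate_nets \<Sigma> // net_equiv \<Sigma>,
      mult = (\<lambda>X Y. \<Union>u\<in>X. \<Union>v\<in>Y. net_class \<Sigma> (net_append u v)),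
      one = net_class \<Sigma> (const_net [])\<rparr>"

definition iota :: "'a set \<Rightarrow> 'a list \<Rightarrow> (real \<Rightarrow> 'a list) set" where
  "iota \<Sigma> w = net_class \<Sigma> (const_net w)"


subsection \<open>The quotient is well defined\<close>

lemma longest_common_suffix_rev:
  "longest_common_suffix u v = rev (longest_common_prefix (rev u) (rev v))"
proof -
  let ?s = "rev (longest_common_prefix (rev u) (rev v))"
  have 1: "suffix ?s u \<and> suffix ?s v"
    by (simp add: suffix_to_prefix longest_common_prefix_prefix1 longest_common_prefix_prefix2)
  have 2: "suffix s ?s" if "suffix s u" "suffix s v" for s
    using that by (simp add: suffix_to_prefix longest_common_prefix_max_prefix)
  show ?thesis
    unfolding longest_common_suffix_def
  proof (rule arg_maxI[where P = "\<lambda>s. suffix s u \<and> suffix s v"])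
    show "suffix ?s u \<and> suffix ?s v" by (rule 1)
  next
    fix s assume "suffix s u \<and> suffix s v"
    then show "\<not> length ?s < length s" using 2 suffix_length_le[of s ?s] by auto
  next
    fix s assume s: "suffix s u \<and> suffix s v"
      and max: "\<forall>t. suffix t u \<and> suffix t v \<longrightarrow> \<not> length s < length t"
    have "suffix s ?s" using s 2 by blast
    moreover have "length ?s \<le> length s" using max 1 by (meson not_less)
    ultimately show "s = ?s"
      by (metis le_antisym suffix_length_le suffix_order.eq_iff suffix_length_suffix)
  qed
qed

lemma lcs_rev: "lcs u v = lcp (rev u) (rev v)"
  by (simp add: lcs_def lcp_def longest_common_suffix_rev)

lemma lcp_commute: "lcp u v = lcp v u"
proof -
  have "longest_common_prefix u v = longest_common_prefix v u"
    by (meson longest_common_prefix_max_prefix longest_common_prefix_prefix1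
        longest_common_prefix_prefix2 prefix_order.antisym)
  then show ?thesis by (simp add: lcp_def)
qed

lemma lcp_nonneg: "0 \<le> lcp u v"
  by (simp add: lcp_def)

lemma lcp_same: "lcp u u = \<infinity>"
  by (simp add: lcp_def)

lemma lcp_Nil: "lcp [] v = (if v = [] then \<infinity> else 0)" "lcp u [] = (if u = [] then \<infinity> else 0)"
  by (auto simp: lcp_def zero_ereal_def)

lemma lcp_Cons: "lcp (x # xs) (y # ys) = (if x = y then lcp xs ys + 1 else 0)"
  by (auto simp: lcp_def zero_ereal_def one_ereal_def)

lemma min_add_one_le:
  fixes a b c :: ereal
  assumes "min a b \<le> c"
  shows "min (a + 1) (b + 1) \<le> c + 1"
proof (cases "a \<le> b")
  case True
  then have "a \<le> c" using assms by (simp add: min_def)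
  then have "a + 1 \<le> c + 1" by (rule add_right_mono)
  then show ?thesis by (rule min.coboundedI1)
next
  case False
  then have "b \<le> c" using assms by (simp add: min_def)
  then have "b + 1 \<le> c + 1" by (rule add_right_mono)
  then show ?thesis by (rule min.coboundedI2)
qed

lemma lcp_trans: "min (lcp u v) (lcp v w) \<le> lcp u w"
proof (induction u v arbitrary: w rule: longest_common_prefix.induct)
  case (1 x xs y ys)
  show ?case
  proof (cases w)
    case Nil
    then show ?thesis by (simp add: lcp_Nil)
  next
    case (Cons z zs)
    show ?thesis
    proof (cases "x = y \<and> y = z")
      case True
      then show ?thesis using 1[of zs] Cons by (simp add: lcp_Cons min_add_one_le)
    next
      case False
      then have "lcp (x # xs) (y # ys) = 0 \<or> lcp (y # ys) w = 0"
        using Cons by (auto simp: lcp_Cons)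
      then have "min (lcp (x # xs) (y # ys)) (lcp (y # ys) w) \<le> 0" by (auto simp: min_le_iff_disj)
      then show ?thesis using lcp_nonneg order_trans by blast
    qed
  qed
next
  case ("2_1" v)
  show ?case by (cases "v = []") (auto simp: lcp_Nil lcp_nonneg min_le_iff_disj)
next
  case ("2_2" u)
  show ?case by (cases "u = []") (auto simp: lcp_Nil lcp_nonneg min_le_iff_disj)
qed

lemma lcp_append: "min (lcp u v) (lcp u' v') \<le> lcp (u @ u') (v @ v')"
proof (induction u v rule: longest_common_prefix.induct)
  case (1 x xs y ys)
  show ?case
  proof (cases "x = y")
    case True
    have "lcp u' v' \<le> lcp u' v' + 1"
      by (cases "lcp u' v'") (auto simp: one_ereal_def)
    then have "min (lcp xs ys + 1) (lcp u' v') \<le> min (lcp xs ys + 1) (lcp u' v' + 1)"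
      by (rule min.mono[OF order_refl])
    also have "\<dots> \<le> lcp (xs @ u') (ys @ v') + 1" using 1 True by (simp add: min_add_one_le)
    finally show ?thesis using True by (simp add: lcp_Cons)
  next
    case False
    then show ?thesis by (simp add: lcp_Cons lcp_nonneg)
  qed
next
  case ("2_1" v)
  show ?case by (cases "v = []") (auto simp: lcp_Nil lcp_nonneg min_le_iff_disj)
next
  case ("2_2" u)
  show ?case by (cases "u = []") (auto simp: lcp_Nil lcp_nonneg min_le_iff_disj)
qed

abbreviation agreement :: "'a list \<Rightarrow> 'a list \<Rightarrow> ereal" where
  "agreement u v \<equiv> min (lcp u v) (lcs u v)"

lemma agreement_trans: "min (agreement u v) (agreement v w) \<le> agreement u w"
  using lcp_trans[of u v w] lcp_trans[of "rev u" "rev v" "rev w"]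
  by (auto simp: lcs_rev min_le_iff_disj)

lemma agreement_append: "min (agreement u v) (agreement u' v') \<le> agreement (u @ u') (v @ v')"
  using lcp_append[of u v u' v'] lcp_append[of "rev u'" "rev v'" "rev u" "rev v"]
  by (auto simp: lcs_rev min_le_iff_disj)

lemma net_equiv_combine:
  assumes "(u, v) \<in> net_equiv \<Sigma>" "(u', v') \<in> net_equiv \<Sigma>"
    and "p \<in> moderate_nets \<Sigma>" "q \<in> moderate_nets \<Sigma>"
    and le: "\<And>\<epsilon>. \<epsilon> \<in> {0<..1} \<Longrightarrow>
      min (agreement (u \<epsilon>) (v \<epsilon>)) (agreement (u' \<epsilon>) (v' \<epsilon>)) \<le> agreement (p \<epsilon>) (q \<epsilon>)"
  shows "(p, q) \<in> net_equiv \<Sigma>"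
proof -
  have "\<exists>\<epsilon>0>0. \<forall>\<epsilon>\<in>{0<..1}. \<epsilon> < \<epsilon>0 \<longrightarrow> ereal (real m * log 2 (1 / \<epsilon>)) \<le> agreement (p \<epsilon>) (q \<epsilon>)" for m
  proof -
    obtain a where a: "a > 0"
      "\<And>\<epsilon>. \<epsilon> \<in> {0<..1} \<Longrightarrow> \<epsilon> < a \<Longrightarrow> ereal (real m * log 2 (1 / \<epsilon>)) \<le> agreement (u \<epsilon>) (v \<epsilon>)"
      using assms(1) unfolding net_equiv_def by blast
    obtain b where b: "b > 0"
      "\<And>\<epsilon>. \<epsilon> \<in> {0<..1} \<Longrightarrow> \<epsilon> < b \<Longrightarrow> ereal (real m * log 2 (1 / \<epsilon>)) \<le> agreement (u' \<epsilon>) (v' \<epsilon>)"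
      using assms(2) unfolding net_equiv_def by blast
    have "ereal (real m * log 2 (1 / \<epsilon>)) \<le> agreement (p \<epsilon>) (q \<epsilon>)"
      if "\<epsilon> \<in> {0<..1}" "\<epsilon> < min a b" for \<epsilon>
    proof -
      have "\<epsilon> < a" "\<epsilon> < b" using that(2) by auto
      then have "ereal (real m * log 2 (1 / \<epsilon>))
          \<le> min (agreement (u \<epsilon>) (v \<epsilon>)) (agreement (u' \<epsilon>) (v' \<epsilon>))"
        using a(2) b(2) that(1) by (intro min.boundedI[of _ "agreement (u \<epsilon>) (v \<epsilon>)"]) blast+
      then show ?thesis using le[OF that(1)] by (rule order_trans)
    qed
    moreover have "min a b > 0" using a(1) b(1) by simp
    ultimately show ?thesis by blast
  qed
  then show ?thesis using assms(3,4) unfolding net_equiv_def by blast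
qed

lemma equiv_net_equiv: "equiv (moderate_nets \<Sigma>) (net_equiv \<Sigma>)"
proof (rule equivI)
  show "net_equiv \<Sigma> \<subseteq> moderate_nets \<Sigma> \<times> moderate_nets \<Sigma>"
    by (auto simp: net_equiv_def)
  show "refl_on (moderate_nets \<Sigma>) (net_equiv \<Sigma>)"
    by (auto simp: refl_on_def net_equiv_def lcp_same lcs_rev intro: exI[of _ "1::real"])
  show "sym (net_equiv \<Sigma>)"
    by (simp add: sym_def net_equiv_def lcs_rev lcp_commute)
  show "trans (net_equiv \<Sigma>)"
  proof (rule transI)
    fix u v w assume *: "(u, v) \<in> net_equiv \<Sigma>" "(v, w) \<in> net_equiv \<Sigma>"
    show "(u, w) \<in> net_equiv \<Sigma>"
      by (rule net_equiv_combine[OF *])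
        (use * agreement_trans in \<open>auto simp: net_equiv_def\<close>)
  qed
qed

lemma const_net_moderate:
  assumes "w \<in> lists \<Sigma>" shows "const_net w \<in> moderate_nets \<Sigma>"
proof -
  have "moderate (const_net w)"
    unfolding moderate_def
    by (rule exI[of _ 0], rule exI[of _ "real (length w) + 1"])
      (auto simp: const_net_def intro: exI[of _ "1::real"])
  then show ?thesis
    using assms by (auto simp: moderate_nets_def nets_def const_net_def)
qed

lemma net_append_moderate:
  assumes "u \<in> moderate_nets \<Sigma>" "v \<in> moderate_nets \<Sigma>"
  shows "net_append u v \<in> moderate_nets \<Sigma>"
proof -
  obtain M C a where 1: "C > 0" "a > 0"
    "\<And>\<epsilon>. \<epsilon> \<in> {0<..1} \<Longrightarrow> \<epsilon> < a \<Longrightarrow> real (length (u \<epsilon>)) \<le> C * \<epsilon> powi (- int M)"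
    using assms(1) unfolding moderate_nets_def moderate_def by blast
  obtain N D b where 2: "D > 0" "b > 0"
    "\<And>\<epsilon>. \<epsilon> \<in> {0<..1} \<Longrightarrow> \<epsilon> < b \<Longrightarrow> real (length (v \<epsilon>)) \<le> D * \<epsilon> powi (- int N)"
    using assms(2) unfolding moderate_nets_def moderate_def by blast
  have "real (length (net_append u v \<epsilon>)) \<le> (C + D) * \<epsilon> powi (- int (M + N))"
    if e: "\<epsilon> \<in> {0<..1}" "\<epsilon> < min a b" for \<epsilon>
  proof -
    have ge: "1 \<le> 1 / \<epsilon>" using e by simp
    have eq: "\<epsilon> powi (- int k) = (1 / \<epsilon>) ^ k" for k
      by (simp add: power_int_minus power_one_over inverse_eq_divide)
    have "real (length (u \<epsilon>)) \<le> C * (1 / \<epsilon>) ^ M" using 1(3)[of \<epsilon>] e unfolding eq by simp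
    also have "\<dots> \<le> C * (1 / \<epsilon>) ^ (M + N)"
      using 1(1) by (intro mult_left_mono power_increasing ge) auto
    finally have u: "real (length (u \<epsilon>)) \<le> C * (1 / \<epsilon>) ^ (M + N)" .
    have "real (length (v \<epsilon>)) \<le> D * (1 / \<epsilon>) ^ N" using 2(3)[of \<epsilon>] e unfolding eq by simp
    also have "\<dots> \<le> D * (1 / \<epsilon>) ^ (M + N)"
      using 2(1) by (intro mult_left_mono power_increasing ge) auto
    finally have v: "real (length (v \<epsilon>)) \<le> D * (1 / \<epsilon>) ^ (M + N)" .
    show ?thesis
      unfolding eq distrib_right using u v e by (simp add: net_append_def)
  qed
  moreover have "C + D > 0" "min a b > 0" using 1 2 by auto
  ultimately have "moderate (net_append u v)" unfolding moderate_def by blast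
  then show ?thesis
    using assms by (auto simp: moderate_nets_def nets_def net_append_def PiE_iff)
qed

lemma net_append_equiv:
  assumes "(u, v) \<in> net_equiv \<Sigma>" "(u', v') \<in> net_equiv \<Sigma>"
  shows "(net_append u u', net_append v v') \<in> net_equiv \<Sigma>"
proof (rule net_equiv_combine[OF assms])
  show "net_append u u' \<in> moderate_nets \<Sigma>" "net_append v v' \<in> moderate_nets \<Sigma>"
    using assms by (auto simp: net_equiv_def intro!: net_append_moderate)
next
  fix \<epsilon> :: real assume "\<epsilon> \<in> {0<..1}"
  then show "min (agreement (u \<epsilon>) (v \<epsilon>)) (agreement (u' \<epsilon>) (v' \<epsilon>))
      \<le> agreement (net_append u u' \<epsilon>) (net_append v v' \<epsilon>)"
    unfolding net_append_def restrict_def by (simp only: if_True agreement_append)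
qed

lemma mult_net_class:
  assumes "u \<in> moderate_nets \<Sigma>" "v \<in> moderate_nets \<Sigma>"
  shows "net_class \<Sigma> u \<otimes>\<^bsub>gen_word_monoid \<Sigma>\<^esub> net_class \<Sigma> v = net_class \<Sigma> (net_append u v)"
proof -
  have "congruent2 (net_equiv \<Sigma>) (net_equiv \<Sigma>) (\<lambda>u v. net_class \<Sigma> (net_append u v))"
    unfolding net_class_def
    by (intro congruent2I') (rule equiv_class_eq[OF equiv_net_equiv net_append_equiv])
  then show ?thesis
    using UN_equiv_class2[OF equiv_net_equiv equiv_net_equiv _ assms]
    by (simp add: gen_word_monoid_def net_class_def)
qed

lemma monoid_word_monoid: "Group.monoid (word_monoid \<Sigma>)"
  by (rule monoidI) (auto simp: word_monoid_def)

lemma monoid_gen_word_monoid: "Group.monoid (gen_word_monoid \<Sigma>)"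
proof -
  let ?G = "gen_word_monoid \<Sigma>"
  have car: "\<exists>u\<in>moderate_nets \<Sigma>. X = net_class \<Sigma> u" if "X \<in> carrier ?G" for X
    using that by (auto simp: gen_word_monoid_def net_class_def elim: quotientE)
  have cl: "net_class \<Sigma> u \<in> carrier ?G" if "u \<in> moderate_nets \<Sigma>" for u
    using that by (simp add: gen_word_monoid_def net_class_def quotientI)
  have one: "\<one>\<^bsub>?G\<^esub> = net_class \<Sigma> (const_net [])" "const_net [] \<in> moderate_nets \<Sigma>"
    by (simp_all add: gen_word_monoid_def const_net_moderate)
  have assoc: "net_append (net_append u v) w = net_append u (net_append v w)" for u v w :: "real \<Rightarrow> 'a list"
    by (auto simp: net_append_def fun_eq_iff)
  have unit: "net_append (const_net []) u = u" "net_append u (const_net []) = u"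
    if "u \<in> moderate_nets \<Sigma>" for u
    using that
    by (auto simp: net_append_def const_net_def moderate_nets_def nets_def PiE_def
        extensional_def fun_eq_iff)
  show ?thesis
  proof (rule monoidI)
    fix X Y assume "X \<in> carrier ?G" "Y \<in> carrier ?G"
    then show "X \<otimes>\<^bsub>?G\<^esub> Y \<in> carrier ?G"
      using car by (metis cl mult_net_class net_append_moderate)
  next
    show "\<one>\<^bsub>?G\<^esub> \<in> carrier ?G" by (simp add: one cl)
  next
    fix X Y Z assume "X \<in> carrier ?G" "Y \<in> carrier ?G" "Z \<in> carrier ?G"
    then obtain u v w where "u \<in> moderate_nets \<Sigma>" "v \<in> moderate_nets \<Sigma>" "w \<in> moderate_nets \<Sigma>"
      "X = net_class \<Sigma> u" "Y = net_class \<Sigma> v" "Z = net_class \<Sigma> w"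
      using car by meson
    then show "X \<otimes>\<^bsub>?G\<^esub> Y \<otimes>\<^bsub>?G\<^esub> Z = X \<otimes>\<^bsub>?G\<^esub> (Y \<otimes>\<^bsub>?G\<^esub> Z)"
      by (simp add: mult_net_class net_append_moderate assoc)
  next
    fix X assume "X \<in> carrier ?G"
    then obtain u where "u \<in> moderate_nets \<Sigma>" "X = net_class \<Sigma> u" using car by blast
    then show "\<one>\<^bsub>?G\<^esub> \<otimes>\<^bsub>?G\<^esub> X = X" "X \<otimes>\<^bsub>?G\<^esub> \<one>\<^bsub>?G\<^esub> = X"
      by (simp_all add: one mult_net_class unit)
  qed
qed

end

theory Submission
  imports Defs
begin

text \<open>
  Concatenation and the unit are computed representative by representative, so that \<open>\<iota>\<close> is a
  homomorphism because the concatenation of two constant nets is the constant net of the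
  concatenated words. For injectivity, the point is that the agreement of two constant nets does
  not depend on \<open>\<epsilon>\<close>: two different words agree on a fixed finite number of letters, whereas
  equivalence demands, already for \<open>m = 1\<close>, an agreement of at least \<open>log\<^sub>2 (1/\<epsilon>)\<close>, which is
  unbounded as \<open>\<epsilon> \<rightarrow> 0\<close>. Hence equivalent constant nets come from equal words
  (\<open>const_net_equiv_imp_eq\<close>).
\<close>

lemma net_append_const_net: "net_append (const_net u) (const_net v) = const_net (u @ v)"
  by (auto simp: net_append_def const_net_def fun_eq_iff)

lemma log_inverse_unbounded_near_zero:
  fixes L a :: real
  assumes "a > 0"
  obtains \<epsilon> where "\<epsilon> \<in> {0<..1}" "\<epsilon> < a" "L < log 2 (1 / \<epsilon>)"
proof -
  obtain k :: nat where k: "L < real k" using reals_Archimedean2 by blast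
  define \<epsilon> where "\<epsilon> = min (a / 2) (1 / 2 ^ k)"
  have pos: "\<epsilon> > 0" and le: "\<epsilon> \<le> 1 / 2 ^ k" and "\<epsilon> < a"
    using assms by (auto simp: \<epsilon>_def)
  have "(1::real) / 2 ^ k \<le> 1" by simp
  then have "\<epsilon> \<le> 1" using le by linarith
  have "2 ^ k \<le> 1 / \<epsilon>" using le pos by (simp add: field_simps)
  then have "real k \<le> log 2 (1 / \<epsilon>)"
    using pos by (simp add: le_log_iff powr_realpow)
  then show thesis using that \<open>\<epsilon> \<le> 1\<close> \<open>\<epsilon> < a\<close> pos k by force
qed

lemma const_net_equiv_imp_eq:
  assumes equiv: "(const_net u, const_net v) \<in> net_equiv \<Sigma>"
  shows "u = v"
proof (rule ccontr)
  assume "u \<noteq> v"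
  then obtain L :: real where L: "lcp u v = ereal L" by (simp add: lcp_def)
  \<comment> \<open>The equivalence condition at \<open>m = 1\<close>.\<close>
  obtain a where a: "a > 0"
    "\<forall>\<epsilon>\<in>{0<..1}. \<epsilon> < a \<longrightarrow> ereal (real 1 * log 2 (1 / \<epsilon>))
      \<le> agreement (const_net u \<epsilon>) (const_net v \<epsilon>)"
    using equiv unfolding net_equiv_def by blast
  obtain \<epsilon> where e: "\<epsilon> \<in> {0<..1}" "\<epsilon> < a" "L < log 2 (1 / \<epsilon>)"
    using log_inverse_unbounded_near_zero[OF a(1)] by blast
  have "ereal (log 2 (1 / \<epsilon>)) \<le> lcp u v"
    using a(2) e(1,2) by (force simp: const_net_def)
  then show False using e(3) L by simp
qed

theorem proposition3p1:
  fixes \<Sigma> :: "'a set"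
  assumes "finite \<Sigma>" and "\<Sigma> \<noteq> {}"
  shows "iota \<Sigma> \<in> hom (word_monoid \<Sigma>) (gen_word_monoid \<Sigma>) \<and>
         iota \<Sigma> \<one>\<^bsub>word_monoid \<Sigma>\<^esub> = \<one>\<^bsub>gen_word_monoid \<Sigma>\<^esub> \<and>
         inj_on (iota \<Sigma>) (carrier (word_monoid \<Sigma>))"
proof (intro conjI)
  show "iota \<Sigma> \<in> hom (word_monoid \<Sigma>) (gen_word_monoid \<Sigma>)"
  proof (rule homI)
    fix w assume "w \<in> carrier (word_monoid \<Sigma>)"
    then show "iota \<Sigma> w \<in> carrier (gen_word_monoid \<Sigma>)"
      by (simp add: word_monoid_def gen_word_monoid_def iota_def net_class_def quotientI
          const_net_moderate)
  next
    fix u v assume "u \<in> carrier (word_monoid \<Sigma>)" "v \<in> carrier (word_monoid \<Sigma>)"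
    then have "const_net u \<in> moderate_nets \<Sigma>" "const_net v \<in> moderate_nets \<Sigma>"
      by (simp_all add: word_monoid_def const_net_moderate)
    then show "iota \<Sigma> (u \<otimes>\<^bsub>word_monoid \<Sigma>\<^esub> v) = iota \<Sigma> u \<otimes>\<^bsub>gen_word_monoid \<Sigma>\<^esub> iota \<Sigma> v"
      by (simp add: iota_def mult_net_class net_append_const_net) (simp add: word_monoid_def)
  qed
next
  show "iota \<Sigma> \<one>\<^bsub>word_monoid \<Sigma>\<^esub> = \<one>\<^bsub>gen_word_monoid \<Sigma>\<^esub>"
    by (simp add: word_monoid_def gen_word_monoid_def iota_def)
next
  show "inj_on (iota \<Sigma>) (carrier (word_monoid \<Sigma>))"
  proof (rule inj_onI)
    fix u v assume "u \<in> carrier (word_monoid \<Sigma>)" "v \<in> carrier (word_monoid \<Sigma>)"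
      and eq: "iota \<Sigma> u = iota \<Sigma> v"
    then have uv: "u \<in> lists \<Sigma>" "v \<in> lists \<Sigma>" by (simp_all add: word_monoid_def)
    have "(const_net u, const_net v) \<in> net_equiv \<Sigma>"
      using eq eq_equiv_class[OF _ equiv_net_equiv const_net_moderate[OF uv(2)]]
      by (simp add: iota_def net_class_def)
    then show "u = v" by (rule const_net_equiv_imp_eq)
  qed
qed

end
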